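(* The meet-compact L$_1$-models form a Hennessy-Milner class: for all meet-compact L$_1$-models $\mathfrak{M}=(W,1,\curlywedge,V)$, $\mathfrak{M}'=(W',1',\curlywedge',V')$ and states $w\in W$, $w'\in W'$, we have $\mathrm{th}_{\mathfrak{M}}(w)\subseteq\mathrm{th}_{\mathfrak{M}'}(w')$ if and only if there exists an L$_1$-simulation $S$ from $\mathfrak{M}$ to $\mathfrak{M}'$ with $(w,w')\in S$.
   Context: $\mathcal{L}$ is generated by $\phi ::= p\mid\top\mid\bot\mid\phi\wedge\phi\mid\phi\vee\phi$, $p$ in a fixed set $\mathrm{Prop}$. A meet-semilattice $(W,1,\curlywedge)$ is a poset in which every finite subset has a meet; $\curlywedge$ binary meet, $1$ top, $w\preccurlyeq v$ iff $w\curlywedge v=w$. A filter is a $\preccurlyeq$-upward closed subset closed under finite meets. An L$_1$-model $(W,1,\curlywedge,V)$ is a meet-semilattice with $V(p)$ a filter for each $p$. Satisfaction: $w\Vdash p$ iff $w\in V(p)$; $w\Vdash\top$ always; $w\Vdash\bot$ iff $w=1$; $\wedge$ classical; $w\Vdash\phi_1\vee\phi_2$ iff there are $u,v$ with $u\curlywedge v\preccurlyeq w$, $u\Vdash\phi_1$, $v\Vdash\phi_2$. $\mathrm{th}_{\mathfrak{M}}(w)=\{\phi\in\mathcal{L}\mid\mathfrak{M},w\Vdash\phi\}$, $[\![\phi]\!]=\{w\mid w\Vdash\phi\}$. $\tau_V$ is the topology on $W$ generated by the subbase $\{[\![\phi]\!]\}\cup\{W\setminus[\![\phi]\!]\}$,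 $\phi\in\mathcal{L}$. $\mathfrak{M}$ is meet-compact if for all $w\in W$ the set $\{(v,u)\in W\times W\mid v\curlywedge u\preccurlyeq w\}$ is compact in $(W,\tau_V)\times(W,\tau_V)$. An L$_1$-simulation from $\mathfrak{M}$ to $\mathfrak{M}'$ is $S\subseteq W\times W'$ such that for all $(w,w')\in S$: (S1) $w\in V(p)$ implies $w'\in V'(p)$ for all $p$; (S2) $w=1$ implies $w'=1'$; (S3) if $v\curlywedge u\preccurlyeq w$ then there exist $v',u'\in W'$ with $(v,v'),(u,u')\in S$ and $v'\curlywedge'u'\preccurlyeq' w'$. *)

theory Defs
  imports "HOL-Analysis.Product_Topology"
begin

datatype 'p form =
    Atom 'p
  | Tru
  | Fls
  | Conj "'p form" "'p form"
  | Disj "'p form" "'p form"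

text \<open>
  A meet-semilattice with top is a type of class \<open>bounded_semilattice_inf_top\<close>: \<open>W\<close> is the
  whole type, \<open>1\<close> is \<open>top\<close>, the binary meet is \<open>inf\<close>, and the order is \<open>\<le>\<close>
  (by \<open>inf.order_iff\<close>, \<open>w \<le> v\<close> iff \<open>w = inf w v\<close>). A model is then given by its valuation.
\<close>

text \<open>Closure under finite meets includes the empty meet, so \<open>top\<close> belongs to every filter.\<close>

definition meet_filter :: "'w::bounded_semilattice_inf_top set \<Rightarrow> bool" where
  "meet_filter F \<longleftrightarrow>
     (\<forall>w\<in>F. \<forall>v. w \<le> v \<longrightarrow> v \<in> F) \<and> top \<in> F \<and> (\<forall>w\<in>F. \<forall>v\<in>F. inf w v \<in> F)"

definition L1_model :: "('p \<Rightarrow> 'w::bounded_semilattice_inf_top set) \<Rightarrow> bool" where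
  "L1_model V \<longleftrightarrow> (\<forall>p. meet_filter (V p))"

primrec sat :: "('p \<Rightarrow> 'w::bounded_semilattice_inf_top set) \<Rightarrow> 'w \<Rightarrow> 'p form \<Rightarrow> bool" where
  "sat V w (Atom p) \<longleftrightarrow> w \<in> V p"
| "sat V w Tru \<longleftrightarrow> True"
| "sat V w Fls \<longleftrightarrow> w = top"
| "sat V w (Conj \<phi> \<psi>) \<longleftrightarrow> sat V w \<phi> \<and> sat V w \<psi>"
| "sat V w (Disj \<phi> \<psi>) \<longleftrightarrow> (\<exists>u v. inf u v \<le> w \<and> sat V u \<phi> \<and> sat V v \<psi>)"

definition th :: "('p \<Rightarrow> 'w::bounded_semilattice_inf_top set) \<Rightarrow> 'w \<Rightarrow> 'p form set" where
  "th V w = {\<phi>. sat V w \<phi>}"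

definition truth_set :: "('p \<Rightarrow> 'w::bounded_semilattice_inf_top set) \<Rightarrow> 'p form \<Rightarrow> 'w set" where
  "truth_set V \<phi> = {w. sat V w \<phi>}"

text \<open>The topology \<open>\<tau>\<^sub>V\<close>; its \<open>topspace\<close> is \<open>UNIV\<close> because \<open>truth_set V Tru = UNIV\<close>.\<close>

definition tau :: "('p \<Rightarrow> 'w::bounded_semilattice_inf_top set) \<Rightarrow> 'w topology" where
  "tau V = topology_generated_by (range (truth_set V) \<union> range (\<lambda>\<phi>. UNIV - truth_set V \<phi>))"

definition meet_compact :: "('p \<Rightarrow> 'w::bounded_semilattice_inf_top set) \<Rightarrow> bool" where
  "meet_compact V \<longleftrightarrow>
     (\<forall>w. compactin (prod_topology (tau V) (tau V)) {(v, u). inf v u \<le> w})"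

definition L1_simulation ::
  "('p \<Rightarrow> 'w::bounded_semilattice_inf_top set) \<Rightarrow> ('p \<Rightarrow> 'v::bounded_semilattice_inf_top set)
    \<Rightarrow> ('w \<times> 'v) set \<Rightarrow> bool" where
  "L1_simulation V V' S \<longleftrightarrow>
     (\<forall>(w, w') \<in> S.
        (\<forall>p. w \<in> V p \<longrightarrow> w' \<in> V' p) \<and>
        (w = top \<longrightarrow> w' = top) \<and>
        (\<forall>v u. inf v u \<le> w \<longrightarrow>
           (\<exists>v' u'. (v, v') \<in> S \<and> (u, u') \<in> S \<and> inf v' u' \<le> w')))"

end

theory Submission
  imports Defs
begin

text \<open>
  Inclusion of theories is itself a simulation. For (S3), let \<open>inf v u \<le> w\<close>. If \<open>\<phi>\<close> and \<open>\<psi>\<close> are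
  finite conjunctions of formulas true at \<open>v\<close> and at \<open>u\<close>, then \<open>\<phi> \<or> \<psi>\<close> holds at \<open>w\<close>, hence at
  \<open>w'\<close>, so some pair \<open>(v', u')\<close> below \<open>w'\<close> satisfies \<open>\<phi>\<close> and \<open>\<psi>\<close>. The finite intersection
  property for the closed sets \<open>\<lbrakk>\<phi>\<rbrakk> \<times> \<lbrakk>\<psi>\<rbrakk>\<close> gives one pair that works for all \<open>\<phi>\<close> and \<open>\<psi>\<close>.
\<close>

lemma sat_foldr_Conj:
  "sat V w (foldr Conj \<phi>s Tru) \<longleftrightarrow> (\<forall>\<phi>\<in>set \<phi>s. sat V w \<phi>)"
  by (induction \<phi>s) auto

lemma topspace_tau: "topspace (tau V) = UNIV"
proof -
  have "truth_set V Tru = UNIV"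
    by (simp add: truth_set_def)
  then show ?thesis
    unfolding tau_def topology_generated_by_topspace by blast
qed

text \<open>The subbase of \<open>tau V\<close> also contains the complement of each truth
  set.\<close>

lemma closedin_truth_set: "closedin (tau V) (truth_set V \<phi>)"
  unfolding closedin_def topspace_tau
  by (auto simp: tau_def intro: topology_generated_by_Basis)

text \<open>Induction on the formula: (S1) handles atoms, (S2) handles \<open>Fls\<close>, and (S3)
  transfers the two witnesses of a disjunction. These witnesses are new states, so the related pair
  must be arbitrary in the induction.\<close>

lemma sat_if_simulation:
  assumes "L1_simulation V V' S" and "(w, w') \<in> S" and "sat V w \<phi>"
  shows "sat V' w' \<phi>"
  using assms(2,3)
proof (induction \<phi> arbitrary: w w')
  case (Disj \<phi> \<psi>)
  then obtain v u where vu: "inf v u \<le> w" "sat V v \<phi>" "sat V u \<psi>"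
    by auto
  then obtain v' u' where "(v, v') \<in> S" "(u, u') \<in> S" "inf v' u' \<le> w'"
    using bspec[OF assms(1)[unfolded L1_simulation_def] Disj.prems(1)]
    unfolding prod.case by meson
  with vu Disj.IH show ?case
    unfolding sat.simps by blast
qed (use assms(1) in \<open>auto simp: L1_simulation_def\<close>)

lemma th_subset_lift_decomposition:
  assumes "meet_compact V'" and sub: "th V w \<subseteq> th V' w'" and "inf v u \<le> w"
  obtains v' u' where "th V v \<subseteq> th V' v'" "th V u \<subseteq> th V' u'" "inf v' u' \<le> w'"
proof -
  let ?K = "{(v', u'). inf v' u' \<le> w'}"
  let ?box = "\<lambda>(\<phi>, \<psi>). truth_set V' \<phi> \<times> truth_set V' \<psi>"
  let ?\<U> = "?box ` (th V v \<times> th V u)"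
  have closed: "\<forall>C\<in>?\<U>. closedin (prod_topology (tau V') (tau V')) C"
    by (auto simp: closedin_prod_Times_iff closedin_truth_set)
  have fip: "?K \<inter> \<Inter>\<F> \<noteq> {}" if \<F>: "finite \<F>" "\<F> \<subseteq> ?\<U>" for \<F>
  proof -
    obtain C where C: "C \<subseteq> th V v \<times> th V u" "finite C" "\<F> = ?box ` C"
      using finite_subset_image[OF \<F>] by blast
    obtain \<chi>s where \<chi>s: "set \<chi>s = C"
      using finite_list[OF C(2)] by blast
    \<comment> \<open>The finitely many boxes come from the pairs in \<open>C\<close>; conjoining
      first and second components separately packs them into one disjunction. If \<open>C\<close> is
      empty, both conjunctions are \<open>Tru\<close>.\<close>
    let ?\<phi> = "foldr Conj (map fst \<chi>s) Tru" and ?\<psi> = "foldr Conj (map snd \<chi>s) Tru"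
    have "sat V v ?\<phi>" "sat V u ?\<psi>"
      using C(1) \<chi>s by (auto simp: sat_foldr_Conj th_def)
    then have "sat V w (Disj ?\<phi> ?\<psi>)"
      using assms(3) by auto
    then have "sat V' w' (Disj ?\<phi> ?\<psi>)"
      using sub unfolding th_def by blast
    then obtain v' u' where "inf v' u' \<le> w'" "sat V' v' ?\<phi>" "sat V' u' ?\<psi>"
      by auto
    then have "(v', u') \<in> ?K \<inter> \<Inter>\<F>"
      unfolding C(3) sat_foldr_Conj using \<chi>s by (fastforce simp: truth_set_def)
    then show ?thesis
      by blast
  qed
  have "compactin (prod_topology (tau V') (tau V')) ?K"
    using assms(1) unfolding meet_compact_def by blast
  then have "?K \<inter> \<Inter>?\<U> \<noteq> {}"
    using closed fip unfolding compactin_fip by presburger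
  then obtain v' u' where vu': "inf v' u' \<le> w'"
    and all: "\<And>\<phi> \<psi>. \<phi> \<in> th V v \<Longrightarrow> \<psi> \<in> th V u \<Longrightarrow> sat V' v' \<phi> \<and> sat V' u' \<psi>"
    by (auto simp: truth_set_def)
  \<comment> \<open>\<open>all\<close> speaks only of pairs of formulas, so \<open>Tru\<close>
    serves as the partner when one formula is treated alone.\<close>
  have "Tru \<in> th V v" "Tru \<in> th V u"
    by (simp_all add: th_def)
  with all have "th V v \<subseteq> th V' v'" "th V u \<subseteq> th V' u'"
    unfolding th_def[of V'] by blast+
  with vu' that show ?thesis
    by blast
qed

lemma L1_simulation_th_subset:
  assumes "meet_compact V'"
  shows "L1_simulation V V' {(w, w'). th V w \<subseteq> th V' w'}"
proof -
  have sat: "sat V' w' \<phi>" if "th V w \<subseteq> th V' w'" "sat V w \<phi>" for w w' \<phi>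
    using that by (auto simp: th_def)
  \<comment> \<open>(S1) and (S2) are instances of theory inclusion, since \<open>Fls\<close> holds
    exactly at \<open>top\<close>.\<close>
  have "w' \<in> V' p" if "th V w \<subseteq> th V' w'" "w \<in> V p" for w w' p
    using sat[OF that(1), of "Atom p"] that(2) by simp
  moreover have "w' = top" if "th V w \<subseteq> th V' w'" "w = top" for w w'
    using sat[OF that(1), of Fls] that(2) by simp
  moreover have "\<exists>v' u'. th V v \<subseteq> th V' v' \<and> th V u \<subseteq> th V' u' \<and> inf v' u' \<le> w'"
    if "th V w \<subseteq> th V' w'" "inf v u \<le> w" for w w' v u
    using th_subset_lift_decomposition[OF assms that] by metis
  ultimately show ?thesis
    unfolding L1_simulation_def by blast
qed

theorem theorem5p6:
  fixes V :: "'p \<Rightarrow> 'w::bounded_semilattice_inf_top set"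
    and V' :: "'p \<Rightarrow> 'v::bounded_semilattice_inf_top set"
    and w :: 'w and w' :: 'v
  assumes "L1_model V" and "meet_compact V"
    and "L1_model V'" and "meet_compact V'"
  shows "th V w \<subseteq> th V' w' \<longleftrightarrow> (\<exists>S. L1_simulation V V' S \<and> (w, w') \<in> S)"
proof
  assume "th V w \<subseteq> th V' w'"
  then show "\<exists>S. L1_simulation V V' S \<and> (w, w') \<in> S"
    using L1_simulation_th_subset[OF assms(4)] by blast
next
  assume "\<exists>S. L1_simulation V V' S \<and> (w, w') \<in> S"
  then show "th V w \<subseteq> th V' w'"
    unfolding th_def using sat_if_simulation by blast
qed

end
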